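(* The dual optimizer of $\mathrm{OT}(\mu,\nu,c)$ is unique (up to translation) if and only if the graph $G$ associated to $\mathrm{OT}(\mu,\nu,c)$ is connected.
   Context: $\mu,\nu$ are probability measures on $\mathbb{R}^d$ with finite supports $\mathcal{X}$, $\mathcal{Y}$ respectively (every point of $\mathcal{X}$, resp. $\mathcal{Y}$, has positive mass), and $c:\mathcal{X}\times\mathcal{Y}\to[0,\infty)$. $\Pi(\mu,\nu)$ is the set of probability measures on $\mathcal{X}\times\mathcal{Y}$ with marginals $\mu$ and $\nu$. $\mathrm{OT}(\mu,\nu,c)=\inf_{\gamma\in\Pi(\mu,\nu)}\int c\,d\gamma$; a minimizer is called a primal optimizer. A pair $(\varphi,\psi)$, $\varphi:\mathcal{X}\to\mathbb{R}$, $\psi:\mathcal{Y}\to\mathbb{R}$, is feasible if $\varphi(x)+\psi(y)\le c(x,y)$ for all $x\in\mathcal{X},y\in\mathcal{Y}$; a dual optimizer is a feasible pair maximizing $\int\varphi\,d\mu+\int\psi\,d\nu$ among feasible pairs. "Unique (up to translation)" means that any two dual optimizers differ by a replacement of $(\varphi,\psi)$ by $(\varphi+a,\psi-a)$ for some $a\in\mathbb{R}$. The graph $G$ associated to $\mathrm{OT}(\mu,\nu,c)$ is the bipartite graph with vertex classes $\mathcal{X}$ and $\mathcal{Y}$ (elements of $\mathcal{X}$ and of $\mathcal{Y}$ are regarded as distinct vertices), in which $x\in\mathcal{X}$ and $y\in\mathcal{Y}$ are joined by an edge iff $\gamma(x,y)>0$ for some primal optimizer $\gamma$. *)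

theory Defs
  imports
    "HOL-Probability.Probability"
    "Graph_Theory.Digraph_Component"
begin

text \<open>
  A finitely supported probability measure is a \<^typ>\<open>'a pmf\<close> with finite
  \<^const>\<open>set_pmf\<close>; the latter is exactly the set of points of positive mass.
  The marginal conditions already force a coupling to be concentrated on
  the product of the two supports.
\<close>

definition couplings :: "'a pmf \<Rightarrow> 'b pmf \<Rightarrow> ('a \<times> 'b) pmf set" where
  "couplings \<mu> \<nu> = {\<gamma>. map_pmf fst \<gamma> = \<mu> \<and> map_pmf snd \<gamma> = \<nu>}"

definition transport_cost :: "('a \<Rightarrow> 'b \<Rightarrow> real) \<Rightarrow> ('a \<times> 'b) pmf \<Rightarrow> real" where
  "transport_cost c \<gamma> = measure_pmf.expectation \<gamma> (\<lambda>(x, y). c x y)"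

definition OT :: "'a pmf \<Rightarrow> 'b pmf \<Rightarrow> ('a \<Rightarrow> 'b \<Rightarrow> real) \<Rightarrow> real" where
  "OT \<mu> \<nu> c = (INF \<gamma>\<in>couplings \<mu> \<nu>. transport_cost c \<gamma>)"

definition primal_optimizer ::
    "'a pmf \<Rightarrow> 'b pmf \<Rightarrow> ('a \<Rightarrow> 'b \<Rightarrow> real) \<Rightarrow> ('a \<times> 'b) pmf \<Rightarrow> bool" where
  "primal_optimizer \<mu> \<nu> c \<gamma> \<longleftrightarrow> \<gamma> \<in> couplings \<mu> \<nu> \<and> transport_cost c \<gamma> = OT \<mu> \<nu> c"

text \<open>
  Potentials are total functions, but only their values on the supports matter:
  all notions below are insensitive to the values elsewhere.
\<close>

definition dual_feasible ::
    "'a pmf \<Rightarrow> 'b pmf \<Rightarrow> ('a \<Rightarrow> 'b \<Rightarrow> real) \<Rightarrow> ('a \<Rightarrow> real) \<Rightarrow> ('b \<Rightarrow> real) \<Rightarrow> bool" where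
  "dual_feasible \<mu> \<nu> c \<phi> \<psi> \<longleftrightarrow> (\<forall>x\<in>set_pmf \<mu>. \<forall>y\<in>set_pmf \<nu>. \<phi> x + \<psi> y \<le> c x y)"

definition dual_value :: "'a pmf \<Rightarrow> 'b pmf \<Rightarrow> ('a \<Rightarrow> real) \<Rightarrow> ('b \<Rightarrow> real) \<Rightarrow> real" where
  "dual_value \<mu> \<nu> \<phi> \<psi> = measure_pmf.expectation \<mu> \<phi> + measure_pmf.expectation \<nu> \<psi>"

definition dual_optimizer ::
    "'a pmf \<Rightarrow> 'b pmf \<Rightarrow> ('a \<Rightarrow> 'b \<Rightarrow> real) \<Rightarrow> ('a \<Rightarrow> real) \<Rightarrow> ('b \<Rightarrow> real) \<Rightarrow> bool" where
  "dual_optimizer \<mu> \<nu> c \<phi> \<psi> \<longleftrightarrow> dual_feasible \<mu> \<nu> c \<phi> \<psi> \<and>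
     (\<forall>\<phi>' \<psi>'. dual_feasible \<mu> \<nu> c \<phi>' \<psi>' \<longrightarrow> dual_value \<mu> \<nu> \<phi>' \<psi>' \<le> dual_value \<mu> \<nu> \<phi> \<psi>)"

definition dual_optimizer_unique_up_to_translation ::
    "'a pmf \<Rightarrow> 'b pmf \<Rightarrow> ('a \<Rightarrow> 'b \<Rightarrow> real) \<Rightarrow> bool" where
  "dual_optimizer_unique_up_to_translation \<mu> \<nu> c \<longleftrightarrow>
     (\<forall>\<phi> \<psi> \<phi>' \<psi>'. dual_optimizer \<mu> \<nu> c \<phi> \<psi> \<and> dual_optimizer \<mu> \<nu> c \<phi>' \<psi>' \<longrightarrow>
        (\<exists>a. (\<forall>x\<in>set_pmf \<mu>. \<phi>' x = \<phi> x + a) \<and> (\<forall>y\<in>set_pmf \<nu>. \<psi>' y = \<psi> y - a)))"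

text \<open>
  An undirected graph is a symmetric digraph without loops or parallel arcs. The disjoint
  sum keeps the two vertex classes apart even if the supports overlap.
\<close>

definition ot_edges :: "'a pmf \<Rightarrow> 'b pmf \<Rightarrow> ('a \<Rightarrow> 'b \<Rightarrow> real) \<Rightarrow> ('a \<times> 'b) set" where
  "ot_edges \<mu> \<nu> c = {(x, y). x \<in> set_pmf \<mu> \<and> y \<in> set_pmf \<nu> \<and>
     (\<exists>\<gamma>. primal_optimizer \<mu> \<nu> c \<gamma> \<and> pmf \<gamma> (x, y) > 0)}"

definition ot_graph :: "'a pmf \<Rightarrow> 'b pmf \<Rightarrow> ('a \<Rightarrow> 'b \<Rightarrow> real) \<Rightarrow> ('a + 'b) pair_pre_digraph" where
  "ot_graph \<mu> \<nu> c =
     \<lparr> pverts = set_pmf \<mu> <+> set_pmf \<nu>,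
       parcs = (\<Union>(x, y)\<in>ot_edges \<mu> \<nu> c. {(Inl x, Inr y), (Inr y, Inl x)}) \<rparr>"

lemma graph_ot_graph:
  assumes "finite (set_pmf \<mu>)" "finite (set_pmf \<nu>)"
  shows "graph (with_proj (ot_graph \<mu> \<nu> c))"
proof -
  have sub: "ot_edges \<mu> \<nu> c \<subseteq> set_pmf \<mu> \<times> set_pmf \<nu>"
    by (auto simp: ot_edges_def)
  then have "finite (ot_edges \<mu> \<nu> c)"
    using assms finite_subset by blast
  then show ?thesis
    using sub assms
    by unfold_locales
      (auto simp: ot_graph_def arc_to_ends_def symmetric_def intro!: symI)
qed

end

theory Submission
  imports Defs "HOL-Complex_Analysis.Great_Picard"
begin

text \<open>
  Perturbations of an optimal coupling \<open>\<gamma>\<close> are signed matrices that are nonnegative off its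
  support. Those with zero marginals have nonnegative cost, so the infimal cost of perturbations
  moving a unit of mass between two rows yields Kantorovich potentials tight on the support of
  \<open>\<gamma>\<close>; hence strong duality. Consequently every dual optimizer is tight on the edges of the
  graph, and two of them differ by a constant on each connected component.

  Conversely, direct the tight pairs of a dual optimizer from \<open>x\<close> to \<open>y\<close> and the support of
  \<open>\<gamma>\<close> from \<open>y\<close> to \<open>x\<close>. If some vertex set is closed under these arcs but not everything,
  shifting the potentials slightly on it gives a dual optimizer that is not a translate. So
  uniqueness makes every tight pair lie on a tight cycle; pushing mass along the cycle preserves
  optimality, so tight pairs are edges. The same shift then excludes a proper connected component.
\<close>

section \<open>Finite sums over the supports and pairings with signed matrices\<close>

lemma sum_mult_of_bool_single:
  fixes f :: "'a \<Rightarrow> real"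
  assumes "finite S" "u \<in> S"
  shows "(\<Sum>x\<in>S. f x * of_bool (x = u)) = f u"
proof -
  have "(\<Sum>x\<in>S. f x * of_bool (x = u)) = (\<Sum>x\<in>S. if x = u then f x else 0)"
    by (intro sum.cong) auto
  also have "\<dots> = f u"
    using assms by (simp only: sum.delta if_True)
  finally show ?thesis .
qed

locale finite_transport =
  fixes \<mu> :: "'a pmf" and \<nu> :: "'b pmf" and c :: "'a \<Rightarrow> 'b \<Rightarrow> real"
  assumes finite_X: "finite (set_pmf \<mu>)" and finite_Y: "finite (set_pmf \<nu>)"
    and cost_nonneg: "\<And>x y. x \<in> set_pmf \<mu> \<Longrightarrow> y \<in> set_pmf \<nu> \<Longrightarrow> 0 \<le> c x y"
begin

abbreviation "X \<equiv> set_pmf \<mu>"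
abbreviation "Y \<equiv> set_pmf \<nu>"

text \<open>The integral of \<open>f\<close> against a signed matrix on \<open>X \<times> Y\<close>.
  Couplings and their perturbations both enter as \<open>\<theta>\<close>, so no sign or mass
  condition is imposed.\<close>

definition pairing :: "('a \<Rightarrow> 'b \<Rightarrow> real) \<Rightarrow> ('a \<Rightarrow> 'b \<Rightarrow> real) \<Rightarrow> real" where
  "pairing f \<theta> = (\<Sum>x\<in>X. \<Sum>y\<in>Y. f x y * \<theta> x y)"

lemma pairing_add_right: "pairing f (\<lambda>x y. \<theta> x y + \<eta> x y) = pairing f \<theta> + pairing f \<eta>"
  by (simp add: pairing_def distrib_left sum.distrib)

lemma pairing_scale_right: "pairing f (\<lambda>x y. k * \<theta> x y) = k * pairing f \<theta>"
  by (simp add: pairing_def sum_distrib_left mult_ac)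

lemma pairing_diff_left: "pairing (\<lambda>x y. f x y - g x y) \<theta> = pairing f \<theta> - pairing g \<theta>"
  by (simp add: pairing_def left_diff_distrib sum_subtractf)

lemma pairing_cong:
  assumes "\<And>x y. x \<in> X \<Longrightarrow> y \<in> Y \<Longrightarrow> f x y * \<theta> x y = g x y * \<eta> x y"
  shows "pairing f \<theta> = pairing g \<eta>"
  unfolding pairing_def using assms by (intro sum.cong) auto

text \<open>Summing out one variable leaves only the marginals of \<open>\<theta>\<close>. Hence a
  sum of potentials has the same integral against all couplings and pairs to zero with matrices of
  zero marginals.\<close>

lemma pairing_separable:
  "pairing (\<lambda>x y. \<phi> x + \<psi> y) \<theta> =
     (\<Sum>x\<in>X. \<phi> x * (\<Sum>y\<in>Y. \<theta> x y)) + (\<Sum>y\<in>Y. \<psi> y * (\<Sum>x\<in>X. \<theta> x y))"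
proof -
  have "(\<Sum>x\<in>X. \<Sum>y\<in>Y. \<psi> y * \<theta> x y) = (\<Sum>y\<in>Y. \<psi> y * (\<Sum>x\<in>X. \<theta> x y))"
    by (subst sum.swap) (simp add: sum_distrib_left)
  then show ?thesis
    by (simp add: pairing_def distrib_right sum.distrib sum_distrib_left)
qed

section \<open>Couplings as matrices with prescribed marginals\<close>

lemma coupling_support:
  assumes "\<gamma> \<in> couplings \<mu> \<nu>" shows "set_pmf \<gamma> \<subseteq> X \<times> Y"
proof
  fix p assume "p \<in> set_pmf \<gamma>"
  then have "fst p \<in> set_pmf (map_pmf fst \<gamma>)" "snd p \<in> set_pmf (map_pmf snd \<gamma>)"
    by auto
  with assms show "p \<in> X \<times> Y"
    by (cases p) (auto simp: couplings_def)
qed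

lemma coupling_row_sum:
  assumes "\<gamma> \<in> couplings \<mu> \<nu>" shows "(\<Sum>y\<in>Y. pmf \<gamma> (x, y)) = pmf \<mu> x"
proof -
  have "pmf \<mu> x = measure \<gamma> (fst -` {x})"
    using assms by (auto simp: couplings_def pmf_map)
  \<comment> \<open>\<open>\<gamma>\<close> is concentrated on \<open>X \<times> Y\<close>, so the
    two events differ by a null set, also for \<open>x\<close> outside \<open>X\<close>.\<close>
  also have "\<dots> = measure \<gamma> ({x} \<times> Y)"
    using coupling_support[OF assms]
    by (intro measure_pmf.finite_measure_eq_AE) (auto simp: AE_measure_pmf_iff)
  also have "\<dots> = sum (pmf \<gamma>) ({x} \<times> Y)"
    using finite_Y by (simp add: measure_measure_pmf_finite)
  also have "\<dots> = (\<Sum>y\<in>Y. pmf \<gamma> (x, y))"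
    by (subst sum.cartesian_product'[of "pmf \<gamma>"]) simp
  finally show ?thesis by simp
qed

lemma coupling_column_sum:
  assumes "\<gamma> \<in> couplings \<mu> \<nu>" shows "(\<Sum>x\<in>X. pmf \<gamma> (x, y)) = pmf \<nu> y"
proof -
  have "pmf \<nu> y = measure \<gamma> (snd -` {y})"
    using assms by (auto simp: couplings_def pmf_map)
  also have "\<dots> = measure \<gamma> (X \<times> {y})"
    using coupling_support[OF assms]
    by (intro measure_pmf.finite_measure_eq_AE) (auto simp: AE_measure_pmf_iff)
  also have "\<dots> = sum (pmf \<gamma>) (X \<times> {y})"
    using finite_X by (simp add: measure_measure_pmf_finite)
  also have "\<dots> = (\<Sum>x\<in>X. pmf \<gamma> (x, y))"
    by (subst sum.cartesian_product'[of "pmf \<gamma>"]) simp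
  finally show ?thesis by simp
qed

lemma coupling_row_positive:
  assumes "\<gamma> \<in> couplings \<mu> \<nu>" "x \<in> X" obtains y where "y \<in> Y" "pmf \<gamma> (x, y) > 0"
proof -
  have "(\<Sum>y\<in>Y. pmf \<gamma> (x, y)) > 0"
    using assms by (simp add: coupling_row_sum pmf_positive_iff)
  then obtain y where "y \<in> Y" "pmf \<gamma> (x, y) \<noteq> 0"
    by (metis less_irrefl sum.neutral)
  then show ?thesis using that[of y] pmf_nonneg[of \<gamma> "(x, y)"] by simp
qed

lemma coupling_column_positive:
  assumes "\<gamma> \<in> couplings \<mu> \<nu>" "y \<in> Y" obtains x where "x \<in> X" "pmf \<gamma> (x, y) > 0"
proof -
  have "(\<Sum>x\<in>X. pmf \<gamma> (x, y)) > 0"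
    using assms by (simp add: coupling_column_sum pmf_positive_iff)
  then obtain x where "x \<in> X" "pmf \<gamma> (x, y) \<noteq> 0"
    by (metis less_irrefl sum.neutral)
  then show ?thesis using that[of x] pmf_nonneg[of \<gamma> "(x, y)"] by simp
qed

lemma transport_cost_eq_pairing:
  assumes "\<gamma> \<in> couplings \<mu> \<nu>"
  shows "transport_cost c \<gamma> = pairing c (\<lambda>x y. pmf \<gamma> (x, y))"
proof -
  have "transport_cost c \<gamma> = (\<Sum>p\<in>X \<times> Y. (case p of (x, y) \<Rightarrow> c x y) * pmf \<gamma> p)"
    unfolding transport_cost_def using coupling_support[OF assms] finite_X finite_Y
    by (intro integral_measure_pmf_real) auto
  also have "\<dots> = pairing c (\<lambda>x y. pmf \<gamma> (x, y))"
    unfolding pairing_def by (subst sum.cartesian_product') simp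
  finally show ?thesis .
qed

lemma dual_value_eq_pairing:
  assumes "\<gamma> \<in> couplings \<mu> \<nu>"
  shows "dual_value \<mu> \<nu> \<phi> \<psi> = pairing (\<lambda>x y. \<phi> x + \<psi> y) (\<lambda>x y. pmf \<gamma> (x, y))"
proof -
  have "measure_pmf.expectation \<mu> \<phi> = (\<Sum>x\<in>X. \<phi> x * pmf \<mu> x)"
    "measure_pmf.expectation \<nu> \<psi> = (\<Sum>y\<in>Y. \<psi> y * pmf \<nu> y)"
    using finite_X finite_Y by (auto intro!: integral_measure_pmf_real)
  then show ?thesis
    by (simp add: dual_value_def pairing_separable coupling_row_sum[OF assms]
        coupling_column_sum[OF assms])
qed

text \<open>The way back from matrices to measures: it turns entrywise limits and perturbations of
  couplings into couplings.\<close>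

lemma coupling_of_matrix:
  assumes nonneg: "\<And>x y. x \<in> X \<Longrightarrow> y \<in> Y \<Longrightarrow> 0 \<le> \<theta> x y"
    and row: "\<And>x. x \<in> X \<Longrightarrow> (\<Sum>y\<in>Y. \<theta> x y) = pmf \<mu> x"
    and column: "\<And>y. y \<in> Y \<Longrightarrow> (\<Sum>x\<in>X. \<theta> x y) = pmf \<nu> y"
  shows "\<exists>\<gamma>\<in>couplings \<mu> \<nu>. \<forall>x\<in>X. \<forall>y\<in>Y. pmf \<gamma> (x, y) = \<theta> x y"
proof -
  \<comment> \<open>Extension by zero off \<open>X \<times> Y\<close> gives a nonnegative function
    of total mass 1, as \<open>embed_pmf\<close> requires.\<close>
  define f where "f p = (if p \<in> X \<times> Y then \<theta> (fst p) (snd p) else 0)" for p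
  have f_nonneg: "0 \<le> f p" for p
    using nonneg by (auto simp: f_def)
  have total: "(\<Sum>p\<in>X \<times> Y. f p) = 1"
  proof -
    have "(\<Sum>p\<in>X \<times> Y. f p) = (\<Sum>x\<in>X. \<Sum>y\<in>Y. \<theta> x y)"
      by (subst sum.cartesian_product') (simp add: f_def)
    also have "\<dots> = 1"
      using row finite_X by (simp add: sum_pmf_eq_1)
    finally show ?thesis .
  qed
  have "(\<integral>\<^sup>+p. ennreal (f p) \<partial>count_space UNIV) = (\<Sum>p\<in>X \<times> Y. ennreal (f p))"
    using finite_X finite_Y by (intro nn_integral_count_space') (auto simp: f_def)
  also have "\<dots> = 1"
    using total f_nonneg by (simp add: sum_ennreal)
  finally have pmf_f: "pmf (embed_pmf f) p = f p" for p
    using f_nonneg by (intro pmf_embed_pmf)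
  have support: "set_pmf (embed_pmf f) \<subseteq> X \<times> Y"
    by (auto simp: set_pmf_eq pmf_f f_def split: if_splits)
  have "map_pmf fst (embed_pmf f) = \<mu>"
  proof (rule pmf_eqI)
    fix x
    have "pmf (map_pmf fst (embed_pmf f)) x = measure (embed_pmf f) ({x} \<times> Y)"
      unfolding pmf_map using support
      by (intro measure_pmf.finite_measure_eq_AE) (auto simp: AE_measure_pmf_iff)
    also have "\<dots> = (\<Sum>y\<in>Y. f (x, y))"
      using finite_Y
      by (simp add: measure_measure_pmf_finite pmf_f sum.cartesian_product'[of "\<lambda>p. f p"])
    also have "\<dots> = pmf \<mu> x"
      \<comment> \<open>For \<open>x\<close> outside \<open>X\<close> both sides are zero.\<close>
      using row by (cases "x \<in> X") (auto simp: f_def set_pmf_iff)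
    finally show "pmf (map_pmf fst (embed_pmf f)) x = pmf \<mu> x" .
  qed
  moreover have "map_pmf snd (embed_pmf f) = \<nu>"
  proof (rule pmf_eqI)
    fix y
    have "pmf (map_pmf snd (embed_pmf f)) y = measure (embed_pmf f) (X \<times> {y})"
      unfolding pmf_map using support
      by (intro measure_pmf.finite_measure_eq_AE) (auto simp: AE_measure_pmf_iff)
    also have "\<dots> = (\<Sum>x\<in>X. f (x, y))"
      using finite_X
      by (simp add: measure_measure_pmf_finite pmf_f sum.cartesian_product'[of "\<lambda>p. f p"])
    also have "\<dots> = pmf \<nu> y"
      using column by (cases "y \<in> Y") (auto simp: f_def set_pmf_iff)
    finally show "pmf (map_pmf snd (embed_pmf f)) y = pmf \<nu> y" .
  qed
  ultimately show ?thesis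
    by (intro bexI[of _ "embed_pmf f"]) (auto simp: couplings_def pmf_f f_def)
qed

section \<open>Weak duality and complementary slackness\<close>

text \<open>Both values are integrals against \<open>\<gamma>\<close>, and feasibility compares the
  integrands pointwise.\<close>

lemma weak_duality:
  assumes "\<gamma> \<in> couplings \<mu> \<nu>" "dual_feasible \<mu> \<nu> c \<phi> \<psi>"
  shows "dual_value \<mu> \<nu> \<phi> \<psi> \<le> transport_cost c \<gamma>"
  unfolding transport_cost_eq_pairing[OF assms(1)] dual_value_eq_pairing[OF assms(1)] pairing_def
  using assms(2) by (intro sum_mono mult_right_mono) (auto simp: dual_feasible_def)

text \<open>The duality gap is a sum of nonnegative terms, slack times mass, so it vanishes exactly
  when each term does.\<close>

lemma complementary_slackness:
  assumes \<gamma>: "\<gamma> \<in> couplings \<mu> \<nu>" and feasible: "dual_feasible \<mu> \<nu> c \<phi> \<psi>"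
  shows "dual_value \<mu> \<nu> \<phi> \<psi> = transport_cost c \<gamma> \<longleftrightarrow>
    (\<forall>x\<in>X. \<forall>y\<in>Y. pmf \<gamma> (x, y) > 0 \<longrightarrow> \<phi> x + \<psi> y = c x y)"
proof -
  have "transport_cost c \<gamma> - dual_value \<mu> \<nu> \<phi> \<psi> =
      (\<Sum>x\<in>X. \<Sum>y\<in>Y. (c x y - (\<phi> x + \<psi> y)) * pmf \<gamma> (x, y))"
    by (simp add: transport_cost_eq_pairing[OF \<gamma>] dual_value_eq_pairing[OF \<gamma>]
        pairing_def left_diff_distrib sum_subtractf)
  also have "\<dots> = (\<Sum>p\<in>X \<times> Y. (c (fst p) (snd p) - (\<phi> (fst p) + \<psi> (snd p))) * pmf \<gamma> p)"
    by (subst sum.cartesian_product') simp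
  finally have "dual_value \<mu> \<nu> \<phi> \<psi> = transport_cost c \<gamma> \<longleftrightarrow>
      (\<Sum>p\<in>X \<times> Y. (c (fst p) (snd p) - (\<phi> (fst p) + \<psi> (snd p))) * pmf \<gamma> p) = 0"
    by linarith
  also have "\<dots> \<longleftrightarrow> (\<forall>p\<in>X \<times> Y. (c (fst p) (snd p) - (\<phi> (fst p) + \<psi> (snd p))) * pmf \<gamma> p = 0)"
    using feasible finite_X finite_Y
    by (intro sum_nonneg_eq_0_iff) (auto simp: dual_feasible_def)
  finally show ?thesis
    by (force simp: less_le)
qed

section \<open>Existence of an optimal coupling\<close>

lemma OT_le_transport_cost:
  assumes "\<gamma> \<in> couplings \<mu> \<nu>" shows "OT \<mu> \<nu> c \<le> transport_cost c \<gamma>"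
  unfolding OT_def
\<comment> \<open>A real infimum is a lower bound only for sets bounded below; nonnegative costs
  supply the bound 0.\<close>
proof (rule cINF_lower[OF bdd_belowI2 assms])
  fix \<gamma>' assume "\<gamma>' \<in> couplings \<mu> \<nu>"
  then show "0 \<le> transport_cost c \<gamma>'"
    using cost_nonneg by (auto simp: transport_cost_eq_pairing pairing_def intro!: sum_nonneg)
qed

lemma couplings_nonempty: "couplings \<mu> \<nu> \<noteq> {}"
  using map_fst_pair_pmf[of \<mu> \<nu>] map_snd_pair_pmf[of \<mu> \<nu>] by (auto simp: couplings_def)

text \<open>Compactness: along a minimizing sequence \<open>g\<close> the finitely many entries lie
  in [0, 1], so a subsequence \<open>g (k n)\<close> converges entrywise. Marginals and cost are
  finite sums of entries and pass to the limit.\<close>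

lemma primal_optimizer_exists: "\<exists>\<gamma>. primal_optimizer \<mu> \<nu> c \<gamma>"
proof -
  have "\<exists>\<gamma>\<in>couplings \<mu> \<nu>. transport_cost c \<gamma> < OT \<mu> \<nu> c + inverse (real (Suc n))" for n
    using cInf_lessD[of "transport_cost c ` couplings \<mu> \<nu>" "OT \<mu> \<nu> c + inverse (real (Suc n))"]
      couplings_nonempty by (auto simp: OT_def)
  then obtain g where g: "\<And>n. g n \<in> couplings \<mu> \<nu>"
    "\<And>n. transport_cost c (g n) < OT \<mu> \<nu> c + inverse (real (Suc n))"
    by metis
  have "countable (X \<times> Y)" "\<And>n p. norm (pmf (g n) p) \<le> 1"
    using finite_X finite_Y by (auto simp: countable_finite pmf_le_1)
  then obtain k where k: "strict_mono (k :: nat \<Rightarrow> nat)"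
    "\<And>p. p \<in> X \<times> Y \<Longrightarrow> \<exists>l. (\<lambda>n. pmf (g (k n)) p) \<longlonglongrightarrow> l"
    using function_convergent_subsequence[of "X \<times> Y" "\<lambda>n. pmf (g n)" 1] by blast
  then have "\<forall>p\<in>X \<times> Y. \<exists>l. (\<lambda>n. pmf (g (k n)) p) \<longlonglongrightarrow> l"
    by blast
  then obtain \<theta> where \<theta>: "\<And>x y. x \<in> X \<Longrightarrow> y \<in> Y \<Longrightarrow> (\<lambda>n. pmf (g (k n)) (x, y)) \<longlonglongrightarrow> \<theta> (x, y)"
    by (metis SigmaI)
  have "\<exists>\<gamma>\<in>couplings \<mu> \<nu>. \<forall>x\<in>X. \<forall>y\<in>Y. pmf \<gamma> (x, y) = \<theta> (x, y)"
  proof (rule coupling_of_matrix[of "\<lambda>x y. \<theta> (x, y)"])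
    show "0 \<le> \<theta> (x, y)" if "x \<in> X" "y \<in> Y" for x y
      using \<theta>[OF that] by (rule LIMSEQ_le_const) auto
    show "(\<Sum>y\<in>Y. \<theta> (x, y)) = pmf \<mu> x" if "x \<in> X" for x
    proof (rule LIMSEQ_unique)
      show "(\<lambda>n. \<Sum>y\<in>Y. pmf (g (k n)) (x, y)) \<longlonglongrightarrow> (\<Sum>y\<in>Y. \<theta> (x, y))"
        using \<theta> that by (intro tendsto_sum)
      show "(\<lambda>n. \<Sum>y\<in>Y. pmf (g (k n)) (x, y)) \<longlonglongrightarrow> pmf \<mu> x"
        by (simp add: coupling_row_sum[OF g(1)])
    qed
    show "(\<Sum>x\<in>X. \<theta> (x, y)) = pmf \<nu> y" if "y \<in> Y" for y
    proof (rule LIMSEQ_unique)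
      show "(\<lambda>n. \<Sum>x\<in>X. pmf (g (k n)) (x, y)) \<longlonglongrightarrow> (\<Sum>x\<in>X. \<theta> (x, y))"
        using \<theta> that by (intro tendsto_sum)
      show "(\<lambda>n. \<Sum>x\<in>X. pmf (g (k n)) (x, y)) \<longlonglongrightarrow> pmf \<nu> y"
        by (simp add: coupling_column_sum[OF g(1)])
    qed
  qed
  then obtain \<gamma> where \<gamma>: "\<gamma> \<in> couplings \<mu> \<nu>"
    "\<And>x y. x \<in> X \<Longrightarrow> y \<in> Y \<Longrightarrow> pmf \<gamma> (x, y) = \<theta> (x, y)"
    by blast
  have "(\<lambda>n. transport_cost c (g (k n))) \<longlonglongrightarrow> transport_cost c \<gamma>"
    unfolding transport_cost_eq_pairing[OF g(1)] transport_cost_eq_pairing[OF \<gamma>(1)] pairing_def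
    using \<theta> \<gamma>(2) by (intro tendsto_sum tendsto_mult tendsto_const) auto
  moreover have "(\<lambda>n. OT \<mu> \<nu> c + inverse (real (Suc (k n)))) \<longlonglongrightarrow> OT \<mu> \<nu> c + 0"
    using LIMSEQ_subseq_LIMSEQ[OF LIMSEQ_inverse_real_of_nat k(1)]
    by (intro tendsto_add tendsto_const) (simp add: o_def)
  ultimately have "transport_cost c \<gamma> \<le> OT \<mu> \<nu> c + 0"
    by (rule LIMSEQ_le) (use g(2) in \<open>auto intro!: exI[of _ 0] less_imp_le\<close>)
  then have "transport_cost c \<gamma> = OT \<mu> \<nu> c"
    using OT_le_transport_cost[OF \<gamma>(1)] by simp
  with \<gamma>(1) show ?thesis
    by (auto simp: primal_optimizer_def)
qed

section \<open>Perturbations along the residual network\<close>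

text \<open>
  Flows from \<open>s\<close> to \<open>t\<close> in the residual network of \<open>\<gamma>\<close>. Working with matrices instead of
  paths turns concatenation of paths into addition and closed paths into zero marginals.
\<close>

definition residual :: "('a \<times> 'b) pmf \<Rightarrow> 'a \<Rightarrow> 'a \<Rightarrow> ('a \<Rightarrow> 'b \<Rightarrow> real) \<Rightarrow> bool" where
  "residual \<gamma> s t \<theta> \<longleftrightarrow>
     (\<forall>x\<in>X. (\<Sum>y\<in>Y. \<theta> x y) = of_bool (x = s) - of_bool (x = t)) \<and>
     (\<forall>y\<in>Y. (\<Sum>x\<in>X. \<theta> x y) = 0) \<and>
     (\<forall>x\<in>X. \<forall>y\<in>Y. pmf \<gamma> (x, y) = 0 \<longrightarrow> 0 \<le> \<theta> x y)"

text \<open>The two-arc path from \<open>s\<close> through \<open>z\<close> to \<open>t\<close>: one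
  unit of column \<open>z\<close> moves from row \<open>t\<close> to row \<open>s\<close>. For
  \<open>s = t\<close> this is the zero matrix.\<close>

definition exchange :: "'a \<Rightarrow> 'a \<Rightarrow> 'b \<Rightarrow> 'a \<Rightarrow> 'b \<Rightarrow> real" where
  "exchange s t z x y = (if y = z then of_bool (x = s) - of_bool (x = t) else 0)"

lemma residual_zero: "residual \<gamma> s s (\<lambda>_ _. 0)"
  by (simp add: residual_def)

lemma residual_add:
  assumes "residual \<gamma> s t \<theta>" "residual \<gamma> t u \<eta>"
  shows "residual \<gamma> s u (\<lambda>x y. \<theta> x y + \<eta> x y)"
  using assms by (auto simp: residual_def sum.distrib)

text \<open>Only the entry \<open>(t, z)\<close> can be negative, and it lies in the support of
  \<open>\<gamma>\<close>. Since both rows belong to \<open>X\<close>, the entries of column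
  \<open>z\<close> cancel.\<close>

lemma residual_exchange:
  assumes "s \<in> X" "t \<in> X" "z \<in> Y" "pmf \<gamma> (t, z) > 0"
  shows "residual \<gamma> s t (exchange s t z)"
proof -
  have row: "(\<Sum>y\<in>Y. exchange s t z x y) = of_bool (x = s) - of_bool (x = t)" for x
    using assms(3) finite_Y by (simp add: exchange_def)
  have "(\<Sum>x\<in>X. of_bool (x = s) - of_bool (x = t) :: real) = 0"
    using sum_mult_of_bool_single[OF finite_X assms(1), of "\<lambda>_. 1"]
      sum_mult_of_bool_single[OF finite_X assms(2), of "\<lambda>_. 1"]
    unfolding sum_subtractf mult_1 by linarith
  then have column: "(\<Sum>x\<in>X. exchange s t z x y) = 0" for y
    by (cases "y = z") (simp_all add: exchange_def)
  show ?thesis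
    using row column assms(4) by (auto simp: residual_def exchange_def)
qed

lemma pairing_exchange:
  assumes "s \<in> X" "t \<in> X" "z \<in> Y"
  shows "pairing f (exchange s t z) = f s z - f t z"
proof -
  have "f x y * exchange s t z x y =
      (if y = z then f x z * of_bool (x = s) - f x z * of_bool (x = t) else 0)" for x y
    by (simp add: exchange_def right_diff_distrib)
  then have "pairing f (exchange s t z) =
      (\<Sum>x\<in>X. f x z * of_bool (x = s) - f x z * of_bool (x = t))"
    using assms(3) finite_Y by (simp add: pairing_def)
  also have "\<dots> = f s z - f t z"
    unfolding sum_subtractf
    by (simp only: sum_mult_of_bool_single[OF finite_X assms(1)]
        sum_mult_of_bool_single[OF finite_X assms(2)])
  finally show ?thesis .
qed

text \<open>Where \<open>\<gamma>\<close> vanishes, \<open>\<theta>\<close> is nonnegative; where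
  \<open>\<gamma>\<close> is positive, a small step keeps it positive. One \<delta> serves all of
  the finitely many entries, and zero marginals of \<open>\<theta>\<close> preserve those of
  \<open>\<gamma>\<close>.\<close>

lemma residual_perturbation:
  assumes \<gamma>: "\<gamma> \<in> couplings \<mu> \<nu>" and \<theta>: "residual \<gamma> s s \<theta>"
  obtains \<delta> \<gamma>' where "\<delta> > 0" "\<gamma>' \<in> couplings \<mu> \<nu>"
    "\<And>x y. x \<in> X \<Longrightarrow> y \<in> Y \<Longrightarrow> pmf \<gamma>' (x, y) = pmf \<gamma> (x, y) + \<delta> * \<theta> x y"
proof -
  have "\<forall>\<^sub>F \<delta> in at_right 0. 0 \<le> pmf \<gamma> p + \<delta> * \<theta> (fst p) (snd p)" if "p \<in> X \<times> Y" for p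
  proof (cases "pmf \<gamma> p = 0")
    case True
    then have "0 \<le> \<theta> (fst p) (snd p)"
      using \<theta> that by (auto simp: residual_def)
    then show ?thesis
      using True by (auto intro!: eventually_mono[OF eventually_at_right_less])
  next
    case False
    have "((\<lambda>\<delta>. pmf \<gamma> p + \<delta> * \<theta> (fst p) (snd p)) \<longlongrightarrow> pmf \<gamma> p + 0 * \<theta> (fst p) (snd p)) (at_right 0)"
      by (intro tendsto_intros)
    then have "\<forall>\<^sub>F \<delta> in at_right 0. 0 < pmf \<gamma> p + \<delta> * \<theta> (fst p) (snd p)"
      using False pmf_nonneg[of \<gamma> p] by (intro order_tendstoD(1)) auto
    then show ?thesis
      by (rule eventually_mono) simp
  qed
  then have "\<forall>\<^sub>F \<delta> in at_right 0. \<forall>p\<in>X \<times> Y. 0 \<le> pmf \<gamma> p + \<delta> * \<theta> (fst p) (snd p)"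
    using finite_X finite_Y by (intro eventually_ball_finite) auto
  then have "\<forall>\<^sub>F \<delta> in at_right 0. \<delta> > 0 \<and> (\<forall>p\<in>X \<times> Y. 0 \<le> pmf \<gamma> p + \<delta> * \<theta> (fst p) (snd p))"
    using eventually_at_right_less by (rule eventually_conj[rotated])
  then obtain \<delta> :: real where \<delta>: "\<delta> > 0"
    "\<And>x y. x \<in> X \<Longrightarrow> y \<in> Y \<Longrightarrow> 0 \<le> pmf \<gamma> (x, y) + \<delta> * \<theta> x y"
    by (force dest!: eventually_happens'[OF trivial_limit_at_right_real])
  have "\<exists>\<gamma>'\<in>couplings \<mu> \<nu>. \<forall>x\<in>X. \<forall>y\<in>Y. pmf \<gamma>' (x, y) = pmf \<gamma> (x, y) + \<delta> * \<theta> x y"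
  proof (rule coupling_of_matrix[of "\<lambda>x y. pmf \<gamma> (x, y) + \<delta> * \<theta> x y"])
    show "0 \<le> pmf \<gamma> (x, y) + \<delta> * \<theta> x y" if "x \<in> X" "y \<in> Y" for x y
      using \<delta>(2) that .
    show "(\<Sum>y\<in>Y. pmf \<gamma> (x, y) + \<delta> * \<theta> x y) = pmf \<mu> x" if "x \<in> X" for x
      using \<theta> that
      by (simp add: residual_def sum.distrib coupling_row_sum[OF \<gamma>] flip: sum_distrib_left)
    show "(\<Sum>x\<in>X. pmf \<gamma> (x, y) + \<delta> * \<theta> x y) = pmf \<nu> y" if "y \<in> Y" for y
      using \<theta> that
      by (simp add: residual_def sum.distrib coupling_column_sum[OF \<gamma>] flip: sum_distrib_left)
  qed
  with \<delta>(1) that show ?thesis by blast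
qed

text \<open>There are no negative cycles: a small step along one would bring the cost below
  \<open>OT \<mu> \<nu> c\<close>.\<close>

lemma residual_cost_nonneg:
  assumes "primal_optimizer \<mu> \<nu> c \<gamma>" "residual \<gamma> s s \<theta>"
  shows "0 \<le> pairing c \<theta>"
proof -
  have \<gamma>: "\<gamma> \<in> couplings \<mu> \<nu>" "transport_cost c \<gamma> = OT \<mu> \<nu> c"
    using assms(1) by (auto simp: primal_optimizer_def)
  obtain \<delta> \<gamma>' where \<delta>: "\<delta> > 0" and \<gamma>': "\<gamma>' \<in> couplings \<mu> \<nu>"
    "\<And>x y. x \<in> X \<Longrightarrow> y \<in> Y \<Longrightarrow> pmf \<gamma>' (x, y) = pmf \<gamma> (x, y) + \<delta> * \<theta> x y"
    using residual_perturbation[OF \<gamma>(1) assms(2)] by blast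
  have "transport_cost c \<gamma>' = pairing c (\<lambda>x y. pmf \<gamma> (x, y) + \<delta> * \<theta> x y)"
    unfolding transport_cost_eq_pairing[OF \<gamma>'(1)] using \<gamma>'(2) by (intro pairing_cong) simp
  also have "\<dots> = OT \<mu> \<nu> c + \<delta> * pairing c \<theta>"
    by (simp add: pairing_add_right pairing_scale_right transport_cost_eq_pairing[OF \<gamma>(1)] flip: \<gamma>(2))
  finally have "0 \<le> \<delta> * pairing c \<theta>"
    using OT_le_transport_cost[OF \<gamma>'(1)] by simp
  with \<delta> show ?thesis
    by (simp add: zero_le_mult_iff)
qed

text \<open>A small step along a cycle of cost zero stays optimal and puts mass on
  \<open>(x, y)\<close>.\<close>

lemma residual_edge:
  assumes "primal_optimizer \<mu> \<nu> c \<gamma>" "residual \<gamma> s s \<theta>" "pairing c \<theta> = 0"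
    and xy: "x \<in> X" "y \<in> Y" "\<theta> x y > 0"
  shows "(x, y) \<in> ot_edges \<mu> \<nu> c"
proof -
  have \<gamma>: "\<gamma> \<in> couplings \<mu> \<nu>" "transport_cost c \<gamma> = OT \<mu> \<nu> c"
    using assms(1) by (auto simp: primal_optimizer_def)
  obtain \<delta> \<gamma>' where \<delta>: "\<delta> > 0" and \<gamma>': "\<gamma>' \<in> couplings \<mu> \<nu>"
    "\<And>x y. x \<in> X \<Longrightarrow> y \<in> Y \<Longrightarrow> pmf \<gamma>' (x, y) = pmf \<gamma> (x, y) + \<delta> * \<theta> x y"
    using residual_perturbation[OF \<gamma>(1) assms(2)] by blast
  have "transport_cost c \<gamma>' = pairing c (\<lambda>x y. pmf \<gamma> (x, y) + \<delta> * \<theta> x y)"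
    unfolding transport_cost_eq_pairing[OF \<gamma>'(1)] using \<gamma>'(2) by (intro pairing_cong) simp
  also have "\<dots> = OT \<mu> \<nu> c"
    using assms(3)
    by (simp add: pairing_add_right pairing_scale_right transport_cost_eq_pairing[OF \<gamma>(1)] flip: \<gamma>(2))
  finally have "primal_optimizer \<mu> \<nu> c \<gamma>'"
    using \<gamma>'(1) by (simp add: primal_optimizer_def)
  moreover have "pmf \<gamma>' (x, y) > 0"
    using \<gamma>'(2)[OF xy(1,2)] \<delta> xy(3) by (simp add: add_nonneg_pos)
  ultimately show ?thesis
    using xy by (auto simp: ot_edges_def)
qed

section \<open>Strong duality by shortest paths\<close>

text \<open>For a fixed row \<open>s\<close>, the potential \<open>\<phi> x\<close> is the distance
  from \<open>x\<close> to \<open>s\<close> in the residual network. Absence of negative cycles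
  makes it finite, and its triangle inequality makes the pair tight on the support of
  \<open>\<gamma>\<close>, so complementary slackness closes the gap.\<close>

lemma strong_duality:
  assumes opt: "primal_optimizer \<mu> \<nu> c \<gamma>"
  obtains \<phi> \<psi> where "dual_feasible \<mu> \<nu> c \<phi> \<psi>" "dual_value \<mu> \<nu> \<phi> \<psi> = OT \<mu> \<nu> c"
proof -
  have \<gamma>: "\<gamma> \<in> couplings \<mu> \<nu>" "transport_cost c \<gamma> = OT \<mu> \<nu> c"
    using opt by (auto simp: primal_optimizer_def)
  obtain s where s: "s \<in> X"
    using set_pmf_not_empty[of \<mu>] by blast
  define D where "D x = pairing c ` {\<theta>. residual \<gamma> x s \<theta>}" for x
  have bdd: "bdd_below (D x)" if x: "x \<in> X" for x
  proof -
    obtain y where "y \<in> Y" "pmf \<gamma> (x, y) > 0"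
      using coupling_row_positive[OF \<gamma>(1) x] .
    \<comment> \<open>Completing any flow from \<open>x\<close> to \<open>s\<close> by this fixed
      path gives a cycle of nonnegative cost, which bounds the cost of the flow from below.\<close>
    then have return_path: "residual \<gamma> s x (exchange s x y)"
      using s x by (intro residual_exchange)
    have "- pairing c (exchange s x y) \<le> pairing c \<theta>" if "residual \<gamma> x s \<theta>" for \<theta>
      using residual_cost_nonneg[OF opt residual_add[OF that return_path]]
      by (simp add: pairing_add_right)
    then show ?thesis
      by (auto simp: D_def intro!: bdd_belowI2)
  qed
  obtain z where z: "z \<in> Y" "pmf \<gamma> (s, z) > 0"
    using coupling_row_positive[OF \<gamma>(1) s] .
  have nonempty: "D x \<noteq> {}" if "x \<in> X" for x
    using residual_exchange[of x s z \<gamma>] s z that by (auto simp: D_def)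
  define \<phi> where "\<phi> x = Inf (D x)" for x
  \<comment> \<open>Triangle inequality: a flow from \<open>t\<close> to \<open>s\<close> may be
    preceded by the path from \<open>x\<close> through \<open>y\<close> to \<open>t\<close>.\<close>
  have step: "\<phi> x \<le> c x y - c t y + \<phi> t"
    if "x \<in> X" "t \<in> X" "y \<in> Y" "pmf \<gamma> (t, y) > 0" for x t y
  proof -
    have "\<phi> x - (c x y - c t y) \<le> Inf (D t)"
    proof (rule cInf_greatest[OF nonempty[OF that(2)]])
      fix d assume "d \<in> D t"
      then obtain \<theta> where \<theta>: "residual \<gamma> t s \<theta>" "d = pairing c \<theta>"
        by (auto simp: D_def)
      have "residual \<gamma> x s (\<lambda>u v. exchange x t y u v + \<theta> u v)"
        using residual_add[OF residual_exchange \<theta>(1)] that by blast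
      then have "\<phi> x \<le> pairing c (\<lambda>u v. exchange x t y u v + \<theta> u v)"
        unfolding \<phi>_def using bdd[OF that(1)] by (intro cInf_lower) (auto simp: D_def)
      then show "\<phi> x - (c x y - c t y) \<le> d"
        using that \<theta>(2) by (simp add: pairing_add_right pairing_exchange)
    qed
    then show ?thesis by (simp add: \<phi>_def)
  qed
  \<comment> \<open>The \<open>c\<close>-transform of \<open>\<phi>\<close>, the largest choice that
    keeps the pair feasible.\<close>
  define \<psi> where "\<psi> y = (MIN x\<in>X. c x y - \<phi> x)" for y
  have feasible: "dual_feasible \<mu> \<nu> c \<phi> \<psi>"
    unfolding dual_feasible_def
  proof (intro ballI)
    fix x y assume "x \<in> X"
    then have "\<psi> y \<le> c x y - \<phi> x"
      unfolding \<psi>_def using finite_X by (intro Min_le) auto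
    then show "\<phi> x + \<psi> y \<le> c x y" by simp
  qed
  have "\<phi> x + \<psi> y = c x y" if "x \<in> X" "y \<in> Y" "pmf \<gamma> (x, y) > 0" for x y
  proof -
    \<comment> \<open>By \<open>step\<close>, the minimum defining \<open>\<psi> y\<close> is
      attained at every \<open>x\<close> with \<open>(x, y)\<close> in the support.\<close>
    have "c x y - \<phi> x \<le> \<psi> y"
      unfolding \<psi>_def using finite_X step[OF _ that] set_pmf_not_empty[of \<mu>]
      by (intro Min.boundedI) (auto simp: algebra_simps)
    with feasible that show ?thesis
      by (force simp: dual_feasible_def)
  qed
  then have "dual_value \<mu> \<nu> \<phi> \<psi> = OT \<mu> \<nu> c"
    using complementary_slackness[OF \<gamma>(1) feasible] \<gamma>(2) by simp
  with feasible show ?thesis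
    using that by blast
qed

section \<open>Dual optimizers and tightness\<close>

lemma dual_optimizer_iff:
  "dual_optimizer \<mu> \<nu> c \<phi> \<psi> \<longleftrightarrow>
     dual_feasible \<mu> \<nu> c \<phi> \<psi> \<and> dual_value \<mu> \<nu> \<phi> \<psi> = OT \<mu> \<nu> c"
proof -
  obtain \<gamma> where \<gamma>: "primal_optimizer \<mu> \<nu> c \<gamma>"
    using primal_optimizer_exists by blast
  then have "dual_value \<mu> \<nu> \<phi>' \<psi>' \<le> OT \<mu> \<nu> c" if "dual_feasible \<mu> \<nu> c \<phi>' \<psi>'" for \<phi>' \<psi>'
    using weak_duality that by (metis primal_optimizer_def)
  with strong_duality[OF \<gamma>] show ?thesis
    unfolding dual_optimizer_def by (metis order_antisym)
qed

text \<open>Both optimal values equal \<open>OT \<mu> \<nu> c\<close>, so complementary slackness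
  applies to any dual optimizer paired with any primal one.\<close>

lemma dual_optimizer_slackness:
  assumes "dual_optimizer \<mu> \<nu> c \<phi> \<psi>" "primal_optimizer \<mu> \<nu> c \<gamma>"
    "x \<in> X" "y \<in> Y" "pmf \<gamma> (x, y) > 0"
  shows "\<phi> x + \<psi> y = c x y"
  using assms complementary_slackness[of \<gamma> \<phi> \<psi>]
  by (simp add: dual_optimizer_iff primal_optimizer_def)

lemma ot_edge_tight:
  assumes "dual_optimizer \<mu> \<nu> c \<phi> \<psi>" "(x, y) \<in> ot_edges \<mu> \<nu> c"
  shows "\<phi> x + \<psi> y = c x y"
  using assms dual_optimizer_slackness by (auto simp: ot_edges_def)

section \<open>Consequences of uniqueness: shifting potentials\<close>

text \<open>Raise \<open>\<phi>\<close> on \<open>A\<close> and lower \<open>\<psi>\<close> on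
  \<open>B\<close> by a small \<epsilon>. By \<open>closed\<close>, pairs in the support of
  \<open>\<gamma>\<close> stay tight, so optimality persists once feasibility does; by
  \<open>tight\<close>, the pairs whose sum grows have room for it.\<close>

lemma unique_dual_closed_set:
  assumes unique: "dual_optimizer_unique_up_to_translation \<mu> \<nu> c"
    and opt: "primal_optimizer \<mu> \<nu> c \<gamma>" and dual: "dual_optimizer \<mu> \<nu> c \<phi> \<psi>"
    and s: "s \<in> X" "s \<in> A"
    and closed: "\<And>x y. x \<in> X \<Longrightarrow> y \<in> Y \<Longrightarrow> pmf \<gamma> (x, y) > 0 \<Longrightarrow> x \<in> A \<longleftrightarrow> y \<in> B"
    and tight: "\<And>x y. x \<in> X \<Longrightarrow> y \<in> Y \<Longrightarrow> x \<in> A \<Longrightarrow> \<phi> x + \<psi> y = c x y \<Longrightarrow> y \<in> B"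
  shows "X \<subseteq> A \<and> Y \<subseteq> B"
proof -
  have \<gamma>: "\<gamma> \<in> couplings \<mu> \<nu>" "transport_cost c \<gamma> = OT \<mu> \<nu> c"
    using opt by (auto simp: primal_optimizer_def)
  have feasible: "dual_feasible \<mu> \<nu> c \<phi> \<psi>"
    using dual by (simp add: dual_optimizer_def)
  \<comment> \<open>Exactly the pairs on which the shift increases the sum of the potentials; each
    has positive slack.\<close>
  define S where "S = {p \<in> X \<times> Y. fst p \<in> A \<and> snd p \<notin> B}"
  have "\<exists>\<epsilon>>0. \<forall>p\<in>S. \<phi> (fst p) + \<psi> (snd p) + \<epsilon> \<le> c (fst p) (snd p)"
  proof (cases "S = {}")
    case True
    then show ?thesis by (auto intro: exI[of _ 1])
  next
    case False
    define \<epsilon> where "\<epsilon> = (MIN p\<in>S. c (fst p) (snd p) - (\<phi> (fst p) + \<psi> (snd p)))"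
    have fin: "finite S"
      unfolding S_def using finite_X finite_Y by simp
    have "\<phi> (fst p) + \<psi> (snd p) < c (fst p) (snd p)" if "p \<in> S" for p
      using that tight feasible by (fastforce simp: S_def dual_feasible_def order.strict_iff_order)
    then have "\<epsilon> > 0"
      unfolding \<epsilon>_def using fin False by (subst Min_gr_iff) auto
    moreover have "\<epsilon> \<le> c (fst p) (snd p) - (\<phi> (fst p) + \<psi> (snd p))" if "p \<in> S" for p
      unfolding \<epsilon>_def using fin that by (intro Min_le) auto
    ultimately show ?thesis
      by (intro exI[of _ \<epsilon>]) (force simp: algebra_simps)
  qed
  then obtain \<epsilon> where \<epsilon>: "\<epsilon> > 0"
    "\<And>x y. x \<in> X \<Longrightarrow> y \<in> Y \<Longrightarrow> x \<in> A \<Longrightarrow> y \<notin> B \<Longrightarrow> \<phi> x + \<psi> y + \<epsilon> \<le> c x y"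
    by (auto simp: S_def)
  define \<phi>' where "\<phi>' x = \<phi> x + \<epsilon> * of_bool (x \<in> A)" for x
  define \<psi>' where "\<psi>' y = \<psi> y - \<epsilon> * of_bool (y \<in> B)" for y
  have feasible': "dual_feasible \<mu> \<nu> c \<phi>' \<psi>'"
    unfolding dual_feasible_def
  proof (intro ballI)
    fix x y assume xy: "x \<in> X" "y \<in> Y"
    then have "\<phi> x + \<psi> y \<le> c x y"
      using feasible by (simp add: dual_feasible_def)
    then show "\<phi>' x + \<psi>' y \<le> c x y"
      using \<epsilon>(1) \<epsilon>(2)[OF xy] by (auto simp: \<phi>'_def \<psi>'_def)
  qed
  have "\<phi>' x + \<psi>' y = c x y" if "x \<in> X" "y \<in> Y" "pmf \<gamma> (x, y) > 0" for x y
    using closed[OF that] dual_optimizer_slackness[OF dual opt that] by (simp add: \<phi>'_def \<psi>'_def)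
  then have "dual_optimizer \<mu> \<nu> c \<phi>' \<psi>'"
    using complementary_slackness[OF \<gamma>(1) feasible'] feasible' \<gamma>(2) by (simp add: dual_optimizer_iff)
  with dual unique obtain a where a: "\<forall>x\<in>X. \<phi>' x = \<phi> x + a" "\<forall>y\<in>Y. \<psi>' y = \<psi> y - a"
    unfolding dual_optimizer_unique_up_to_translation_def by blast
  \<comment> \<open>The shift at \<open>s\<close> fixes the translation constant. As \<epsilon> is
    nonzero, a shift by \<epsilon> at every vertex forces every vertex into \<open>A\<close> or
    \<open>B\<close>.\<close>
  have "a = \<epsilon>"
    using a(1) s by (auto simp: \<phi>'_def)
  then show ?thesis
    using a \<epsilon>(1) by (auto simp: \<phi>'_def \<psi>'_def of_bool_def split: if_splits)
qed

text \<open>A cycle has zero marginals, so the potentials contribute nothing.\<close>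

lemma pairing_reduced_cost:
  assumes "residual \<gamma> s s \<theta>"
  shows "pairing (\<lambda>x y. c x y - (\<phi> x + \<psi> y)) \<theta> = pairing c \<theta>"
  unfolding pairing_diff_left using assms by (simp add: pairing_separable residual_def)

text \<open>The vertices reachable along tight arcs from a support partner \<open>s\<close> of
  \<open>y\<close> form a closed set, hence everything. A path from \<open>s\<close> to
  \<open>x\<close>, then \<open>(x, y)\<close> and back to \<open>s\<close>, is a cycle of cost zero
  through \<open>(x, y)\<close>.\<close>

lemma unique_dual_tight_edge:
  assumes unique: "dual_optimizer_unique_up_to_translation \<mu> \<nu> c"
    and dual: "dual_optimizer \<mu> \<nu> c \<phi> \<psi>"
    and xy: "x \<in> X" "y \<in> Y" "\<phi> x + \<psi> y = c x y"
  shows "(x, y) \<in> ot_edges \<mu> \<nu> c"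
proof -
  obtain \<gamma> where opt: "primal_optimizer \<mu> \<nu> c \<gamma>"
    using primal_optimizer_exists by blast
  then have \<gamma>: "\<gamma> \<in> couplings \<mu> \<nu>"
    by (simp add: primal_optimizer_def)
  obtain s where s: "s \<in> X" "pmf \<gamma> (s, y) > 0"
    using coupling_column_positive[OF \<gamma> xy(2)] .
  define r where "r x y = c x y - (\<phi> x + \<psi> y)" for x y
  \<comment> \<open>The slack \<open>r\<close> is nonnegative on \<open>X \<times> Y\<close> and
    zero on the support of \<open>\<gamma>\<close>, while \<open>\<theta>\<close> is nonnegative off
    that support. So \<open>pairing r \<theta> = 0\<close> says that the flow uses tight pairs
    only.\<close>
  define A where "A = {t \<in> X. \<exists>\<theta>. residual \<gamma> s t \<theta> \<and> pairing r \<theta> = 0}"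
  define B where "B = {v \<in> Y. \<exists>t\<in>A. r t v = 0}"
  have "X \<subseteq> A \<and> Y \<subseteq> B"
  proof (rule unique_dual_closed_set[OF unique opt dual s(1)])
    show "s \<in> A"
      using s residual_zero[of \<gamma> s] by (auto simp: A_def pairing_def intro!: exI[of _ "\<lambda>_ _. 0"])
    show "v \<in> B" if "u \<in> X" "v \<in> Y" "u \<in> A" "\<phi> u + \<psi> v = c u v" for u v
      using that by (force simp: B_def r_def)
    show "u \<in> A \<longleftrightarrow> v \<in> B" if uv: "u \<in> X" "v \<in> Y" "pmf \<gamma> (u, v) > 0" for u v
    proof
      have r0: "r u v = 0"
        using dual_optimizer_slackness[OF dual opt uv] by (simp add: r_def)
      show "v \<in> B" if "u \<in> A"
        using that uv r0 by (auto simp: B_def)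
      assume "v \<in> B"
      then obtain t \<theta> where t: "t \<in> X" "r t v = 0" "residual \<gamma> s t \<theta>" "pairing r \<theta> = 0"
        by (auto simp: B_def A_def)
      \<comment> \<open>The flow reaching \<open>t\<close> continues along the tight pair
        \<open>(t, v)\<close> and back along the support pair \<open>(u, v)\<close>.\<close>
      have "residual \<gamma> s u (\<lambda>x y. \<theta> x y + exchange t u v x y)"
        using residual_add[OF t(3) residual_exchange] t(1) uv by blast
      moreover have "pairing r (\<lambda>x y. \<theta> x y + exchange t u v x y) = 0"
        using t uv r0 by (simp add: pairing_add_right pairing_exchange)
      ultimately show "u \<in> A"
        using uv by (auto simp: A_def)
    qed
  qed
  then obtain \<theta> where \<theta>: "residual \<gamma> s x \<theta>" "pairing r \<theta> = 0"
    using xy(1) by (auto simp: A_def)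
  define \<eta> where "\<eta> u v = \<theta> u v + exchange x s y u v" for u v
  have cycle: "residual \<gamma> s s \<eta>"
    unfolding \<eta>_def using residual_add[OF \<theta>(1) residual_exchange] s xy by blast
  have "pairing r \<eta> = 0"
    unfolding \<eta>_def using \<theta>(2) s xy dual_optimizer_slackness[OF dual opt s(1) xy(2) s(2)]
    by (simp add: pairing_add_right pairing_exchange) (simp add: r_def)
  then have cost: "pairing c \<eta> = 0"
    using pairing_reduced_cost[OF cycle, of \<phi> \<psi>] by (simp add: r_def[abs_def])
  show ?thesis
  proof (cases "pmf \<gamma> (x, y) = 0")
    case False
    then show ?thesis
      using opt xy pmf_nonneg[of \<gamma> "(x, y)"] by (auto simp: ot_edges_def less_le)
  next
    case True
    \<comment> \<open>Since \<open>\<gamma>\<close> charges \<open>(s, y)\<close> but not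
      \<open>(x, y)\<close>, the rows differ, and the closing path adds 1 at \<open>(x, y)\<close>
      to a nonnegative entry of \<open>\<theta>\<close>.\<close>
    then have "x \<noteq> s" "0 \<le> \<theta> x y"
      using s \<theta>(1) xy by (auto simp: residual_def)
    then have "\<eta> x y > 0"
      by (simp add: \<eta>_def exchange_def)
    then show ?thesis
      using residual_edge[OF opt cycle cost] xy by blast
  qed
qed

section \<open>Connectedness of the graph and the two implications\<close>

lemma ot_graph_simps:
  "verts (with_proj (ot_graph \<mu> \<nu> c)) = X <+> Y"
  "(Inl x, Inr y) \<in> arcs_ends (with_proj (ot_graph \<mu> \<nu> c)) \<longleftrightarrow> (x, y) \<in> ot_edges \<mu> \<nu> c"
  by (auto simp: ot_graph_def)

text \<open>Connectedness refers to reachability after symmetrizing the arcs, and these arcs are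
  symmetric already.\<close>

lemma connected_iff_strongly_connected:
  "connected (with_proj (ot_graph \<mu> \<nu> c)) \<longleftrightarrow> strongly_connected (with_proj (ot_graph \<mu> \<nu> c))"
proof -
  interpret graph "with_proj (ot_graph \<mu> \<nu> c)"
    using finite_X finite_Y by (rule graph_ot_graph)
  show ?thesis
    using symmetric_connected_imp_strongly_connected[OF sym_arcs] reachable_mk_symmetricI
    by (auto simp: connected_def strongly_connected_def)
qed

text \<open>The component of a vertex \<open>s\<close> is closed: support pairs are edges by
  definition, tight pairs by \<open>unique_dual_tight_edge\<close>. So it contains all
  vertices.\<close>

lemma unique_dual_imp_connected:
  assumes unique: "dual_optimizer_unique_up_to_translation \<mu> \<nu> c"
  shows "Digraph_Component.connected (with_proj (ot_graph \<mu> \<nu> c))"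
proof -
  let ?G = "with_proj (ot_graph \<mu> \<nu> c)"
  interpret graph ?G
    using finite_X finite_Y by (rule graph_ot_graph)
  obtain \<gamma> where opt: "primal_optimizer \<mu> \<nu> c \<gamma>"
    using primal_optimizer_exists by blast
  then obtain \<phi> \<psi> where dual: "dual_optimizer \<mu> \<nu> c \<phi> \<psi>"
    using strong_duality dual_optimizer_iff by metis
  obtain s where s: "s \<in> X"
    using set_pmf_not_empty[of \<mu>] by blast
  have edge: "Inl x \<rightarrow>\<^bsub>?G\<^esub> Inr y" "Inr y \<rightarrow>\<^bsub>?G\<^esub> Inl x" if "(x, y) \<in> ot_edges \<mu> \<nu> c" for x y
    using that ot_graph_simps(2) arcs_ends_symmetric[OF sym_arcs] by blast+
  have reach: "X \<subseteq> {x. Inl s \<rightarrow>\<^sup>*\<^bsub>?G\<^esub> Inl x} \<and> Y \<subseteq> {y. Inl s \<rightarrow>\<^sup>*\<^bsub>?G\<^esub> Inr y}"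
  proof (rule unique_dual_closed_set[OF unique opt dual s])
    show "s \<in> {x. Inl s \<rightarrow>\<^sup>*\<^bsub>?G\<^esub> Inl x}"
      using s ot_graph_simps(1) reachable_refl by blast
    show "y \<in> {y. Inl s \<rightarrow>\<^sup>*\<^bsub>?G\<^esub> Inr y}"
      if "x \<in> X" "y \<in> Y" "x \<in> {x. Inl s \<rightarrow>\<^sup>*\<^bsub>?G\<^esub> Inl x}" "\<phi> x + \<psi> y = c x y" for x y
      using that unique_dual_tight_edge[OF unique dual] edge(1) reachable_adj_trans by blast
    show "x \<in> {x. Inl s \<rightarrow>\<^sup>*\<^bsub>?G\<^esub> Inl x} \<longleftrightarrow> y \<in> {y. Inl s \<rightarrow>\<^sup>*\<^bsub>?G\<^esub> Inr y}"
      if "x \<in> X" "y \<in> Y" "pmf \<gamma> (x, y) > 0" for x y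
    proof -
      have "(x, y) \<in> ot_edges \<mu> \<nu> c"
        using that opt by (auto simp: ot_edges_def)
      from edge[OF this] show ?thesis
        using reachable_adj_trans by blast
    qed
  qed
  have "strongly_connected ?G"
  proof (rule strongly_connectedI)
    show "verts ?G \<noteq> {}"
      using s unfolding ot_graph_simps(1) by auto
    fix u v assume "u \<in> verts ?G" "v \<in> verts ?G"
    then have "Inl s \<rightarrow>\<^sup>*\<^bsub>?G\<^esub> u" "Inl s \<rightarrow>\<^sup>*\<^bsub>?G\<^esub> v"
      using reach unfolding ot_graph_simps(1) by auto
    then show "u \<rightarrow>\<^sup>*\<^bsub>?G\<^esub> v"
      using symmetric_reachable' reachable_trans by blast
  qed
  then show ?thesis
    using connected_iff_strongly_connected by simp
qed

lemma connected_imp_unique_dual: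
  assumes connected: "Digraph_Component.connected (with_proj (ot_graph \<mu> \<nu> c))"
  shows "dual_optimizer_unique_up_to_translation \<mu> \<nu> c"
  unfolding dual_optimizer_unique_up_to_translation_def
proof (intro allI impI, elim conjE)
  fix \<phi> \<psi> \<phi>' \<psi>'
  assume dual: "dual_optimizer \<mu> \<nu> c \<phi> \<psi>" "dual_optimizer \<mu> \<nu> c \<phi>' \<psi>'"
  let ?G = "with_proj (ot_graph \<mu> \<nu> c)"
  interpret graph ?G
    using finite_X finite_Y by (rule graph_ot_graph)
  \<comment> \<open>Opposite signs on the two classes: both pairs are tight on an edge, so the
    change of \<phi> at one end equals minus the change of \<psi> at the other. Thus
    \<open>h\<close> is constant along edges, and its constant value is the translation.\<close>
  define h where "h = case_sum (\<lambda>x. \<phi>' x - \<phi> x) (\<lambda>y. \<psi> y - \<psi>' y)"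
  have edge: "h u = h v" if uv: "u \<rightarrow>\<^bsub>?G\<^esub> v" for u v
  proof -
    obtain x y where xy: "(x, y) \<in> ot_edges \<mu> \<nu> c"
      "u = Inl x \<and> v = Inr y \<or> u = Inr y \<and> v = Inl x"
      using uv by (auto simp: ot_graph_def)
    have "\<phi> x + \<psi> y = c x y" "\<phi>' x + \<psi>' y = c x y"
      using dual xy(1) by (auto intro: ot_edge_tight)
    then show ?thesis
      using xy(2) by (auto simp: h_def)
  qed
  obtain s where s: "s \<in> X"
    using set_pmf_not_empty[of \<mu>] by blast
  have "h v = h (Inl s)" if "v \<in> X <+> Y" for v
  proof -
    have "Inl s \<rightarrow>\<^sup>*\<^bsub>?G\<^esub> v"
      using connected s that unfolding connected_iff_strongly_connected strongly_connected_def
        ot_graph_simps(1) by auto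
    then show ?thesis
      by (induction rule: reachable_induct) (auto simp: edge)
  qed
  from this[of "Inl _"] this[of "Inr _"]
  show "\<exists>a. (\<forall>x\<in>X. \<phi>' x = \<phi> x + a) \<and> (\<forall>y\<in>Y. \<psi>' y = \<psi> y - a)"
    by (intro exI[of _ "h (Inl s)"]) (force simp: h_def algebra_simps)
qed

end

theorem corollary3p14:
  fixes \<mu> \<nu> :: "(real ^ 'd) pmf" and c :: "real ^ 'd \<Rightarrow> real ^ 'd \<Rightarrow> real"
  assumes "finite (set_pmf \<mu>)" and "finite (set_pmf \<nu>)"
    and "\<forall>x\<in>set_pmf \<mu>. \<forall>y\<in>set_pmf \<nu>. 0 \<le> c x y"
  shows "dual_optimizer_unique_up_to_translation \<mu> \<nu> c \<longleftrightarrow>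
    Digraph_Component.connected (with_proj (ot_graph \<mu> \<nu> c))"
proof -
  interpret finite_transport \<mu> \<nu> c
    using assms by unfold_locales auto
  show ?thesis
    using unique_dual_imp_connected connected_imp_unique_dual by blast
qed

end
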